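(* Let $J\in C^2(\mathbb R;\mathbb R)$. Let $F_1,F_2\in C^1(\mathbb R;\mathbb R)$ satisfy $$F_2(z)=-F_1(z)\int\frac{F_0(z)}{F_1(z)^2}\,dz$$ (in the sense explained in the context) with some $F_0:\mathbb R\to\mathbb R$. Let $u_1,u_2:\mathbb R^+\to\mathbb R$ be continuous $T$-periodic functions ($T>0$) with $\int_0^T u_s(\tau)\,d\tau=0$ for $s=1,2$, and let $\beta_{i,j}\in\mathbb R$ be defined by $$\int_0^T\int_0^\theta u_i(\theta)u_j(\tau)\,d\tau\,d\theta=\beta_{i,j}T,\qquad i,j\in\{1,2\}.$$ Consider, for $\omega>0$, the system on $\mathbb R$ $$\dot x=F_1(J(x))\sqrt\omega\,u_1(\omega t)+F_2(J(x))\sqrt\omega\,u_2(\omega t).$$ Then the Lie bracket system for this system has the form $$\dot{\bar x}=-\beta_{2,1}\,\nabla J(\bar x)\,F_0(J(\bar x)).$$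
   Context: Notation: $\mathbb R^+$ is the set of non-negative reals. For maps $f,g:\mathbb R^n\to\mathbb R^n$, $L_gf(x)=\lim_{s\to0}\frac{f(x+sg(x))-f(x)}{s}$ and the Lie bracket is $[f,g](x)=L_fg(x)-L_gf(x)$. Here $n=1$, and $\nabla J=J'$. Lie bracket system: for a control-affine system $\dot x=f_0(x)+\sum_{j=1}^\ell f_j(x)\sqrt\omega\,u_j(\omega t)$ with continuous $T$-periodic zero-mean inputs $u_j$ and $\beta_{i,j}=\frac1T\int_0^T\int_0^\theta u_i(\theta)u_j(\tau)\,d\tau\,d\theta$, the associated Lie bracket system is $$\dot{\bar x}=f_0(\bar x)+\sum_{1\le i<j\le\ell}\beta_{j,i}[f_i,f_j](\bar x).$$ Meaning of the integral relation: it is assumed that $F_1(z)\neq0$ except for at most a countable set $Z^*$ of isolated zeros. $\Psi_1(z)=\int\frac{F_0(z)}{F_1(z)^2}dz$ denotes an antiderivative of $F_0/F_1^2$ on the open set $\mathbb R\setminus Z^*$; the relation means $F_2(z)=-F_1(z)\Psi_1(z)$ for $z\notin Z^*$, and $F_2(z^* )=-\lim_{z\to z^*}F_1(z)\Psi_1(z)$ for $z^*\in Z^*$.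
   Formalization: At zeros of F_1 the value of F_0 is read as its limit (proved to exist), since the relation leaves F_0 arbitrary there and the literal formula can fail; the literal formula holds where F_1(J(x)) ≠ 0, and everywhere if F_0 is continuous at those zeros. *)

theory Defs
  imports "HOL-Analysis.Analysis"
begin

(* The derivative L_g f of f along the vector field g. As usual for Lim, the value is
   meaningful only where the limit exists, e.g. where f is differentiable. *)
definition lie_derivative ::
  "('a \<Rightarrow> 'a) \<Rightarrow> ('a \<Rightarrow> 'a) \<Rightarrow> 'a \<Rightarrow> 'a::real_normed_vector"
  where "lie_derivative g f x = Lim (at 0) (\<lambda>s::real. (f (x + s *\<^sub>R g x) - f x) /\<^sub>R s)"

definition lie_bracket ::
  "('a \<Rightarrow> 'a) \<Rightarrow> ('a \<Rightarrow> 'a) \<Rightarrow> 'a \<Rightarrow> 'a::real_normed_vector"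
  where "lie_bracket f g x = lie_derivative f g x - lie_derivative g f x"

(* A control-affine system with l inputs is given by the families f, u: f 0 is the drift, and
   f j, u j for 1 <= j <= l are the control fields and their inputs. An autonomous or
   time-dependent system is represented by its right-hand side. *)
definition control_affine_rhs ::
  "nat \<Rightarrow> (nat \<Rightarrow> 'a \<Rightarrow> 'a) \<Rightarrow> (nat \<Rightarrow> real \<Rightarrow> real) \<Rightarrow> real \<Rightarrow> real \<Rightarrow> 'a \<Rightarrow> 'a::real_normed_vector"
  where "control_affine_rhs l f u \<omega> t x =
    f 0 x + (\<Sum>j = 1..l. (sqrt \<omega> * u j (\<omega> * t)) *\<^sub>R f j x)"

definition input_coeff :: "real \<Rightarrow> (nat \<Rightarrow> real \<Rightarrow> real) \<Rightarrow> nat \<Rightarrow> nat \<Rightarrow> real"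
  where "input_coeff T u i j =
    1 / T * integral {0..T} (\<lambda>\<theta>. integral {0..\<theta>} (\<lambda>\<tau>. u i \<theta> * u j \<tau>))"

definition lie_bracket_rhs ::
  "nat \<Rightarrow> (nat \<Rightarrow> 'a \<Rightarrow> 'a) \<Rightarrow> (nat \<Rightarrow> real \<Rightarrow> real) \<Rightarrow> real \<Rightarrow> 'a \<Rightarrow> 'a::real_normed_vector"
  where "lie_bracket_rhs l f u T x =
    f 0 x + (\<Sum>j = 1..l. \<Sum>i = 1..<j. input_coeff T u j i *\<^sub>R lie_bracket (f i) (f j) x)"

(* F2 = - F1 * (integral of F0 / F1^2): the indefinite integral is some antiderivative \<Psi> on
   the open set where F1 does not vanish (one constant of integration per component), and at a
   zero of F1 the product is read as a limit. *)
definition integral_relation ::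
  "(real \<Rightarrow> real) \<Rightarrow> (real \<Rightarrow> real) \<Rightarrow> (real \<Rightarrow> real) \<Rightarrow> bool"
  where "integral_relation F0 F1 F2 \<longleftrightarrow>
    (\<exists>\<Psi>.
      (\<forall>z. F1 z \<noteq> 0 \<longrightarrow>
         (\<Psi> has_real_derivative F0 z / (F1 z)\<^sup>2) (at z) \<and> F2 z = - F1 z * \<Psi> z) \<and>
      (\<forall>z. F1 z = 0 \<longrightarrow> ((\<lambda>w. F1 w * \<Psi> w) \<longlongrightarrow> - F2 z) (at z)))"

(* The relation above does not involve the values of F0 at the zeros of F1; there F0 is read,
   like the product in that relation, as a limit. *)
definition extended_at_zeros :: "(real \<Rightarrow> real) \<Rightarrow> (real \<Rightarrow> real) \<Rightarrow> real \<Rightarrow> real"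
  where "extended_at_zeros F1 F0 z = (if F1 z = 0 then Lim (at z) F0 else F0 z)"

end

theory Submission
  imports Defs
begin

text \<open>
  Where \<open>F1\<close> does not vanish, differentiating \<open>F2 = - F1 \<Psi>\<close> eliminates \<open>\<Psi>\<close> and gives
  \<open>F0 = F1' F2 - F1 F2'\<close>. The right-hand side is continuous on the whole line, so it provides the
  limit of \<open>F0\<close> at the isolated zeros of \<open>F1\<close>. By the chain rule the bracket of \<open>F1 \<circ> J\<close> and
  \<open>F2 \<circ> J\<close> is \<open>J' (F1 F2' - F1' F2) \<circ> J\<close>.
\<close>

lemma C1_differentiable_on_UNIV_realE:
  fixes f :: "real \<Rightarrow> real"
  assumes "f C1_differentiable_on UNIV"
  obtains f' where "\<And>x. (f has_real_derivative f' x) (at x)" "continuous_on UNIV f'"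
  using assms
  by (auto simp: C1_differentiable_on_def has_real_derivative_iff_has_vector_derivative)

text \<open>The quotient in \<open>lie_derivative\<close> is the difference quotient at
  \<open>0\<close> of \<open>f\<close> along the line through \<open>x\<close> with direction
  \<open>g x\<close>, so the chain rule evaluates it. Since the limit exists, \<open>Lim\<close>
  returns it.\<close>

lemma lie_derivative_real:
  fixes f g :: "real \<Rightarrow> real"
  assumes "(f has_real_derivative D) (at x)"
  shows "lie_derivative g f x = D * g x"
proof -
  have "((\<lambda>s. f (x + s * g x)) has_real_derivative D * g x) (at 0)"
    by (rule DERIV_chain2[where g = "\<lambda>s. x + s * g x"])
      (use assms in \<open>auto intro!: derivative_eq_intros\<close>)
  then have "((\<lambda>s. (f (x + s *\<^sub>R g x) - f x) /\<^sub>R s) \<longlongrightarrow> D * g x) (at 0)"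
    by (simp add: DERIV_def divide_inverse mult.commute)
  then show ?thesis
    unfolding lie_derivative_def by (intro tendsto_Lim) auto
qed

lemma lie_bracket_comp_real:
  fixes J F G :: "real \<Rightarrow> real"
  assumes J: "(J has_real_derivative J') (at x)"
    and F: "(F has_real_derivative F') (at (J x))"
    and G: "(G has_real_derivative G') (at (J x))"
  shows "lie_bracket (\<lambda>x. F (J x)) (\<lambda>x. G (J x)) x = J' * (F (J x) * G' - F' * G (J x))"
  unfolding lie_bracket_def
  by (simp add: lie_derivative_real[OF DERIV_chain2[OF F J]]
      lie_derivative_real[OF DERIV_chain2[OF G J]] algebra_simps)

text \<open>Differentiating the relation gives \<open>F2' = - F1' * \<Psi> z - F0 z / F1 z\<close>.
  Multiplying by \<open>F1 z\<close> and replacing \<open>- F1 z * \<Psi> z\<close> by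
  \<open>F2 z\<close> removes \<open>\<Psi>\<close>, and with it the choice of the constants of
  integration.\<close>

lemma integral_relation_Wronskian:
  fixes F0 F1 F2 :: "real \<Rightarrow> real"
  assumes rel: "integral_relation F0 F1 F2" and nz: "F1 z \<noteq> 0"
    and F1: "(F1 has_real_derivative F1') (at z)"
    and F2: "(F2 has_real_derivative F2') (at z)"
  shows "F0 z = F1' * F2 z - F1 z * F2'"
proof -
  obtain \<Psi> where
    \<Psi>: "\<And>w. F1 w \<noteq> 0 \<Longrightarrow> (\<Psi> has_real_derivative F0 w / (F1 w)\<^sup>2) (at w) \<and> F2 w = - F1 w * \<Psi> w"
    using rel unfolding integral_relation_def by blast
  \<comment> \<open>To be differentiated, the relation must hold on a neighbourhood of
    \<open>z\<close>; continuity of \<open>F1\<close> provides one.\<close>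
  have "eventually (\<lambda>w. F1 w \<noteq> 0) (nhds z)"
    using DERIV_isCont[OF F1] nz
    unfolding isCont_def tendsto_at_iff_tendsto_nhds by (rule tendsto_imp_eventually_ne)
  then have "eventually (\<lambda>w. F2 w = - F1 w * \<Psi> w) (nhds z)"
    by eventually_elim (use \<Psi> in blast)
  then have "((\<lambda>w. - F1 w * \<Psi> w) has_real_derivative F2') (at z)"
    using F2 has_field_derivative_cong_eventually[of F2 "\<lambda>w. - F1 w * \<Psi> w" z UNIV F2'] \<Psi>[OF nz]
    by (auto simp: eventually_nhds_conv_at)
  moreover have "((\<lambda>w. - F1 w * \<Psi> w) has_real_derivative
      - F1' * \<Psi> z - F1 z * (F0 z / (F1 z)\<^sup>2)) (at z)"
    using F1 \<Psi>[OF nz] by (auto intro!: derivative_eq_intros)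
  ultimately have "F2' = - F1' * \<Psi> z - F1 z * (F0 z / (F1 z)\<^sup>2)"
    by (rule DERIV_unique)
  then show ?thesis
    using \<Psi>[OF nz] nz by (simp add: field_simps power2_eq_square)
qed

text \<open>Some punctured neighbourhood of \<open>z\<close> avoids \<open>S\<close>, and there
  \<open>f\<close> coincides with \<open>g\<close>. This is applied with \<open>S\<close> the zero
  set of \<open>F1\<close>, where \<open>F0\<close> is only controlled through nearby
  points.\<close>

lemma tendsto_at_isolated_in:
  fixes f g :: "real \<Rightarrow> real"
  assumes z: "z isolated_in S" and eq: "\<And>w. w \<notin> S \<Longrightarrow> f w = g w" and g: "isCont g z"
  shows "(f \<longlongrightarrow> g z) (at z)"
proof -
  obtain U where "open U" "U \<inter> S = {z}"
    using z unfolding isolated_in_def by blast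
  then have "open U" "z \<in> U" "\<And>w. w \<in> U \<Longrightarrow> w \<noteq> z \<Longrightarrow> g w = f w"
    using eq by (auto simp: set_eq_iff) metis
  then have "eventually (\<lambda>w. g w = f w) (at z)"
    unfolding eventually_at_topological by blast
  then show ?thesis
    using g unfolding isCont_def by (rule Lim_transform_eventually[rotated])
qed

theorem theorem1:
  fixes J F0 F1 F2 :: "real \<Rightarrow> real"
    and u :: "nat \<Rightarrow> real \<Rightarrow> real"
    and T :: real
    and \<beta> :: "nat \<Rightarrow> nat \<Rightarrow> real"
    and f :: "nat \<Rightarrow> real \<Rightarrow> real"
  assumes J_C2: "J C1_differentiable_on UNIV" "deriv J C1_differentiable_on UNIV"
    and F_C1: "F1 C1_differentiable_on UNIV" "F2 C1_differentiable_on UNIV"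
    and F1_zeros: "countable {z. F1 z = 0}" "\<forall>z\<in>{z. F1 z = 0}. z isolated_in {z. F1 z = 0}"
    and F_relation: "integral_relation F0 F1 F2"
    and T_pos: "T > 0"
    and u_cont: "\<forall>s\<in>{1,2}. continuous_on {0..} (u s)"
    and u_periodic: "\<forall>s\<in>{1,2}. \<forall>t\<ge>0. u s (t + T) = u s t"
    and u_mean: "\<forall>s\<in>{1,2}. integral {0..T} (u s) = 0"
    and \<beta>: "\<forall>i\<in>{1,2}. \<forall>j\<in>{1,2}.
      integral {0..T} (\<lambda>\<theta>. integral {0..\<theta>} (\<lambda>\<tau>. u i \<theta> * u j \<tau>)) = \<beta> i j * T"
    and fields: "f 0 = (\<lambda>x. 0)" "f 1 = (\<lambda>x. F1 (J x))" "f 2 = (\<lambda>x. F2 (J x))"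
  shows
    "(\<forall>\<omega>>0. \<forall>t\<ge>0. \<forall>x. control_affine_rhs 2 f u \<omega> t x =
        F1 (J x) * sqrt \<omega> * u 1 (\<omega> * t) + F2 (J x) * sqrt \<omega> * u 2 (\<omega> * t)) \<and>
     (\<forall>z. F1 z = 0 \<longrightarrow> (\<exists>l. (F0 \<longlongrightarrow> l) (at z))) \<and>
     (\<forall>x. lie_bracket_rhs 2 f u T x = - \<beta> 2 1 * deriv J x * extended_at_zeros F1 F0 (J x)) \<and>
     ((\<forall>z. F1 z = 0 \<longrightarrow> isCont F0 z) \<longrightarrow>
        (\<forall>x. lie_bracket_rhs 2 f u T x = - \<beta> 2 1 * deriv J x * F0 (J x)))"
proof -
  obtain G1 where G1: "\<And>z. (F1 has_real_derivative G1 z) (at z)" and G1_cont: "continuous_on UNIV G1"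
    by (rule C1_differentiable_on_UNIV_realE[OF F_C1(1)]) blast
  obtain G2 where G2: "\<And>z. (F2 has_real_derivative G2 z) (at z)" and G2_cont: "continuous_on UNIV G2"
    by (rule C1_differentiable_on_UNIV_realE[OF F_C1(2)]) blast
  have J': "(J has_real_derivative deriv J x) (at x)" for x
    by (rule C1_differentiable_on_UNIV_realE[OF J_C2(1)]) (metis DERIV_imp_deriv)
  \<comment> \<open>\<open>W\<close> is the continuous function on the whole line that serves as the
    common value of \<open>F0\<close>, of its limits and of its extension.\<close>
  define W where "W z = G1 z * F2 z - F1 z * G2 z" for z
  have W_cont: "isCont W z" for z
    using G1_cont G2_cont DERIV_isCont[OF G1] DERIV_isCont[OF G2]
    unfolding W_def by (auto simp: continuous_on_eq_continuous_at)
  have F0_W: "F0 z = W z" if "F1 z \<noteq> 0" for z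
    unfolding W_def by (rule integral_relation_Wronskian[where ?F1.0 = F1 and ?F2.0 = F2, OF F_relation that G1 G2])
  have F0_lim: "(F0 \<longlongrightarrow> W z) (at z)" if "F1 z = 0" for z
    by (rule tendsto_at_isolated_in[where S = "{z. F1 z = 0}"]) (use F1_zeros(2) that F0_W W_cont in auto)
  have ext: "extended_at_zeros F1 F0 z = W z" for z
    unfolding extended_at_zeros_def using F0_W F0_lim[THEN tendsto_Lim[rotated]] by auto
  \<comment> \<open>At a zero of \<open>F1\<close>, continuity makes \<open>F0 z\<close> a limit of
    \<open>F0\<close>, and limits are unique.\<close>
  have F0_cont: "F0 z = W z" if "\<forall>z. F1 z = 0 \<longrightarrow> isCont F0 z" for z
  proof (cases "F1 z = 0")
    case True
    with that have "(F0 \<longlongrightarrow> F0 z) (at z)"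
      by (simp add: isCont_def)
    then show ?thesis
      using F0_lim[OF True] by (rule LIM_unique)
  qed (rule F0_W)
  have coeff: "input_coeff T u 2 1 = \<beta> 2 1"
    using \<beta> T_pos unfolding input_coeff_def by simp
  \<comment> \<open>The bracket contains the negative of \<open>W\<close>, which is the source of
    the minus sign in the result.\<close>
  have "lie_bracket (f 1) (f 2) x = - deriv J x * W (J x)" for x
    unfolding fields W_def lie_bracket_comp_real[OF J' G1 G2] by (simp add: algebra_simps)
  \<comment> \<open>With two inputs the double sum has the single pair \<open>i = 1\<close>,
    \<open>j = 2\<close>, and the drift vanishes.\<close>
  then have rhs: "lie_bracket_rhs 2 f u T x = - \<beta> 2 1 * deriv J x * W (J x)" for x
    using coeff by (simp add: lie_bracket_rhs_def fields(1) numeral_2_eq_2)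
  have "control_affine_rhs 2 f u \<omega> t x =
      F1 (J x) * sqrt \<omega> * u 1 (\<omega> * t) + F2 (J x) * sqrt \<omega> * u 2 (\<omega> * t)" for \<omega> t x
    using fields by (simp add: control_affine_rhs_def numeral_2_eq_2)
  moreover have "\<forall>z. F1 z = 0 \<longrightarrow> (\<exists>l. (F0 \<longlongrightarrow> l) (at z))"
    using F0_lim by blast
  ultimately show ?thesis
    using F0_cont by (simp add: rhs ext)
qed

end
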